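(* Let $h:\mathbb{R}^n\to\mathbb{R}\cup\{+\infty\}$ be a proper function that is locally Lipschitz on a nonempty convex set $S\subseteq\operatorname{int}\operatorname{dom}(h)$. Let $\nu\in(0,1]$ and $\rho\ge0$. Then the following statements hold: (a) If $S$ is open and $h$ is $\nu$-paraconvex on $S$ with constant $\rho$, then for any $x,y\in S$ and any $\zeta\in\partial h(x)$, $$h(y)\ge h(x)+\langle\zeta,y-x\rangle-\rho\|y-x\|^{1+\nu}.$$ Conversely, if this inequality holds for any $x,y\in S$ and any $\zeta\in\partial h(x)$, then $h$ is $\nu$-paraconvex on $S$ with constant $2^{1-\nu}\rho$. (b) If $S$ is open and $h$ is $\nu$-paraconvex on $S$ with constant $\rho$, then $\partial h$ is $\nu$-paramonotone on $S$ with constant $2\rho$, i.e., for any $x,y\in S$, any $\zeta\in\partial h(x)$, and any $\eta\in\partial h(y)$, $$\langle\eta-\zeta,y-x\rangle\ge-2\rho\|x-y\|^{1+\nu}.$$ Conversely, if $\partial h$ is $\nu$-paramonotone on $S$ with constant $\rho$, then $h$ is $\nu$-paraconvex on $S$ with constant $\frac{2^{1-\nu}\rho}{1+\nu}$.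
   Context: $\langle\cdot,\cdot\rangle$ and $\|\cdot\|$ are the Euclidean inner product and norm; $\operatorname{dom}(h)=\{x:h(x)<+\infty\}$ and $\operatorname{int}$ denotes interior. For a function $h$ locally Lipschitz at $\bar x\in\operatorname{int}\operatorname{dom}(h)$ (i.e. Lipschitz on a neighborhood of $\bar x$), the generalized directional derivative is $h^\circ(\bar x;d)=\limsup_{x\to\bar x,\,t\downarrow0}\frac{h(x+td)-h(x)}{t}$ and the Clarke subdifferential is $\partial h(\bar x)=\{\zeta\in\mathbb{R}^n:\langle\zeta,d\rangle\le h^\circ(\bar x;d)\ \forall d\in\mathbb{R}^n\}$. The function $h$ is $\nu$-paraconvex on a convex set $S\subseteq\operatorname{dom}(h)$ with constant $\rho$ if for all $x,y\in S$ and $\lambda\in[0,1]$, $$h(\lambda x+(1-\lambda)y)\le\lambda h(x)+(1-\lambda)h(y)+\rho\min\{\lambda,1-\lambda\}\|x-y\|^{1+\nu}.$$ For $c\ge 0$, $\partial h$ is $\nu$-paramonotone on $S$ with constant $c$ if $\langle\eta-\zeta,y-x\rangle\ge-c\|x-y\|^{1+\nu}$ for all $x,y\in S$, $\zeta\in\partial h(x)$, $\eta\in\partial h(y)$. *)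

theory Defs
  imports "HOL-Analysis.Analysis"
begin

text \<open>
  Functions into \<open>\<real> \<union> {+\<infinity>}\<close> are rendered as \<open>ereal\<close>-valued functions; the exclusion of the
  value \<open>-\<infinity>\<close> is part of properness.
\<close>

definition effective_domain :: "('a \<Rightarrow> ereal) \<Rightarrow> 'a set" where
  "effective_domain h = {x. h x < \<infinity>}"

definition proper_fun :: "('a \<Rightarrow> ereal) \<Rightarrow> bool" where
  "proper_fun h \<longleftrightarrow> (\<forall>x. h x \<noteq> -\<infinity>) \<and> effective_domain h \<noteq> {}"

text \<open>
  The Lipschitz condition holds on a full neighbourhood in the ambient space. The requirement
  \<open>U \<subseteq> effective_domain h\<close> is essential, because \<open>real_of_ereal\<close> sends \<open>\<infinity>\<close> to \<open>0\<close>.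
\<close>

definition locally_lipschitz_at :: "('a::euclidean_space \<Rightarrow> ereal) \<Rightarrow> 'a \<Rightarrow> bool" where
  "locally_lipschitz_at h x \<longleftrightarrow>
     (\<exists>U L. open U \<and> x \<in> U \<and> U \<subseteq> effective_domain h \<and>
            L-lipschitz_on U (\<lambda>y. real_of_ereal (h y)))"

definition locally_lipschitz_on :: "('a::euclidean_space \<Rightarrow> ereal) \<Rightarrow> 'a set \<Rightarrow> bool" where
  "locally_lipschitz_on h S \<longleftrightarrow> (\<forall>x\<in>S. locally_lipschitz_at h x)"

text \<open>
  The upper limit is taken jointly over \<open>y \<rightarrow> x\<close> (with \<open>y = x\<close> allowed) and \<open>t \<down> 0\<close>. This and
  the subdifferential below are only meaningful at points where \<open>h\<close> is locally Lipschitz; there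
  \<open>h\<close> is finite at all arguments that matter for the limit.
\<close>

definition clarke_dderiv :: "('a::euclidean_space \<Rightarrow> ereal) \<Rightarrow> 'a \<Rightarrow> 'a \<Rightarrow> ereal" where
  "clarke_dderiv h x d =
     Limsup (nhds x \<times>\<^sub>F at_right (0::real)) (\<lambda>(y, t). (h (y + t *\<^sub>R d) - h y) / ereal t)"

definition clarke_subdiff :: "('a::euclidean_space \<Rightarrow> ereal) \<Rightarrow> 'a \<Rightarrow> 'a set" where
  "clarke_subdiff h x = {\<zeta>. \<forall>d. ereal (\<zeta> \<bullet> d) \<le> clarke_dderiv h x d}"

definition paraconvex_on ::
    "real \<Rightarrow> real \<Rightarrow> 'a set \<Rightarrow> ('a::euclidean_space \<Rightarrow> ereal) \<Rightarrow> bool" where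
  "paraconvex_on \<nu> \<rho> S h \<longleftrightarrow>
     convex S \<and> S \<subseteq> effective_domain h \<and>
     (\<forall>x\<in>S. \<forall>y\<in>S. \<forall>l\<in>{0..1}.
        h (l *\<^sub>R x + (1 - l) *\<^sub>R y)
          \<le> ereal l * h x + ereal (1 - l) * h y
            + ereal (\<rho> * min l (1 - l) * norm (x - y) powr (1 + \<nu>)))"

definition paramonotone_on ::
    "real \<Rightarrow> real \<Rightarrow> 'a set \<Rightarrow> ('a::euclidean_space \<Rightarrow> 'a set) \<Rightarrow> bool" where
  "paramonotone_on \<nu> c S T \<longleftrightarrow>
     (\<forall>x\<in>S. \<forall>y\<in>S. \<forall>\<zeta>\<in>T x. \<forall>\<eta>\<in>T y.
        (\<eta> - \<zeta>) \<bullet> (y - x) \<ge> - c * norm (x - y) powr (1 + \<nu>))"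

end

theory Submission
  imports Defs
begin

text \<open>
  Both equivalences pass through the subgradient inequality
  \<open>h y \<ge> h x + \<zeta> \<bullet> (y - x) - c * norm (y - x) powr (1 + \<nu>)\<close>.

  Paraconvexity implies it with \<open>c = \<rho>\<close> (\<open>paraconvex_on_imp_subgradient_ineq\<close>): applied to the
  segment from a base point \<open>w\<close> near \<open>x\<close> to \<open>w + (y - x)\<close>, it bounds the difference quotient of
  \<open>h\<close> at \<open>w\<close> in the direction \<open>y - x\<close>, uniformly in the step, so it bounds the Clarke derivative.
  Openness of \<open>S\<close> is what keeps the translated segments inside \<open>S\<close>. Adding two instances of
  the inequality, with \<open>x\<close> and \<open>y\<close> exchanged, gives paramonotonicity.

  Conversely, two instances of the inequality based at a point
  \<open>z = l *\<^sub>R x + (1 - l) *\<^sub>R y\<close> of a segment, averaged with weights \<open>l\<close> and \<open>1 - l\<close>, give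
  paraconvexity (\<open>subgradient_ineq_imp_paraconvex_on\<close>): the linear terms cancel, and the factor
  \<open>2 powr (1 - \<nu>)\<close> is the maximum of \<open>l powr \<nu> + (1 - l) powr \<nu>\<close>. This uses that \<open>h\<close> has
  a Clarke subgradient at \<open>z\<close>, which is a Hahn-Banach argument: the Clarke derivative of a locally
  Lipschitz function is a finite sublinear function of the direction.

  Paramonotonicity implies the subgradient inequality with \<open>c = \<rho> / (1 + \<nu>)\<close>
  (\<open>paramonotone_on_imp_subgradient_ineq\<close>). Along the segment \<open>\<gamma> t = x + t *\<^sub>R d\<close> with
  \<open>d = y - x\<close>, the lower right Dini derivative of \<open>h \<circ> \<gamma>\<close> at \<open>t > 0\<close> is at least
  \<open>\<eta> \<bullet> d\<close> for some subgradient \<open>\<eta>\<close> at \<open>\<gamma> t\<close>, hence at least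
  \<open>\<zeta> \<bullet> d - \<rho> * t powr \<nu> * norm d powr (1 + \<nu>)\<close>. The estimate follows by integrating this over
  \<open>t\<close>. Instead of differentiating almost everywhere, the proof uses that a continuous function
  with nonnegative lower right Dini derivative is nondecreasing (\<open>dini_increasing\<close>).
\<close>

section \<open>Two facts from real and convex analysis\<close>

text \<open>
  A form of the Hahn-Banach theorem: \<open>\<zeta>\<close> is read off from a hyperplane that separates
  \<open>(d, p d)\<close> from the strict epigraph of \<open>p\<close>.
\<close>
lemma sublinear_support:
  fixes p :: "'a::euclidean_space \<Rightarrow> real"
  assumes sub: "\<And>u v. p (u + v) \<le> p u + p v"
    and hom: "\<And>s u. 0 < s \<Longrightarrow> p (s *\<^sub>R u) = s * p u"
  obtains \<zeta> where "\<And>u. \<zeta> \<bullet> u \<le> p u" and "\<zeta> \<bullet> d = p d"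
proof -
  define A where "A = {(u, r). p u < r}"
  have "convex A"
  proof (rule convexI)
    fix z w and a b :: real
    assume zw: "z \<in> A" "w \<in> A" and ab: "0 \<le> a" "0 \<le> b" "a + b = 1"
    obtain u r where z: "z = (u, r)" "p u < r" using zw by (auto simp: A_def)
    obtain v s where w: "w = (v, s)" "p v < s" using zw by (auto simp: A_def)
    consider "a = 0" | "b = 0" | "0 < a" "0 < b" using ab by linarith
    then show "a *\<^sub>R z + b *\<^sub>R w \<in> A"
    proof cases
      case 3
      have "p (a *\<^sub>R u + b *\<^sub>R v) \<le> a * p u + b * p v"
        using sub[of "a *\<^sub>R u" "b *\<^sub>R v"] hom 3 by simp
      also have "\<dots> < a * r + b * s"
        using 3 z w by (intro add_strict_mono mult_strict_left_mono) auto
      finally show ?thesis by (simp add: A_def z w)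
    qed (use ab zw in auto)
  qed
  moreover have "(d, p d + 1) \<in> A" by (simp add: A_def)
  moreover have "A \<inter> {(d, p d)} = {}" by (auto simp: A_def)
  ultimately obtain n c where n: "n \<noteq> 0" "\<forall>z\<in>{(d, p d)}. n \<bullet> z \<le> c" "\<forall>z\<in>A. c \<le> n \<bullet> z"
    using separating_hyperplane_sets[of "{(d, p d)}" A] by (metis Int_commute convex_singleton empty_iff insert_not_empty)
  obtain a b where nab: "n = (a, b)" by (cases n)
  have cA: "c \<le> a \<bullet> u + b * r" if "p u < r" for u r
    using n(3) that by (auto simp: A_def nab)
  have scal: "c \<le> s * (a \<bullet> u + b * r)" if "p u < r" "0 < s" for u r s
    using cA[of "s *\<^sub>R u" "s * r"] hom that by (simp add: algebra_simps)
  \<comment> \<open>Since the strict epigraph is a cone, the separating functional is nonnegative on it.\<close>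
  have pos: "0 \<le> a \<bullet> u + b * r" if "p u < r" for u r
  proof (rule ccontr)
    assume "\<not> ?thesis"
    then have neg: "a \<bullet> u + b * r < 0" by simp
    define k where "k = - (a \<bullet> u + b * r)"
    define s where "s = (\<bar>c\<bar> + 1) / k"
    have "0 < k" using neg by (simp add: k_def)
    then have "0 < s" "s * k = \<bar>c\<bar> + 1" by (simp_all add: s_def)
    moreover have "s * (a \<bullet> u + b * r) = - (s * k)" by (simp add: k_def algebra_simps)
    ultimately show False using scal[OF that, of s] by simp
  qed
  have pos': "0 \<le> a \<bullet> u + b * p u" for u
  proof (rule tendsto_lowerbound)
    show "((\<lambda>r. a \<bullet> u + b * r) \<longlongrightarrow> a \<bullet> u + b * p u) (at_right (p u))"
      by (intro tendsto_intros)
    show "\<forall>\<^sub>F r in at_right (p u). 0 \<le> a \<bullet> u + b * r"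
      using pos by (auto simp: eventually_at_filter)
  qed simp
  have c0: "c \<le> 0"
  proof (rule tendsto_lowerbound)
    show "((\<lambda>s. s * (a \<bullet> d + b * (p d + 1))) \<longlongrightarrow> 0) (at_right 0)"
      by (auto intro!: tendsto_eq_intros)
    show "\<forall>\<^sub>F s in at_right 0. c \<le> s * (a \<bullet> d + b * (p d + 1))"
      using scal[of d "p d + 1"] by (auto simp: eventually_at_filter)
  qed simp
  have touch: "a \<bullet> d + b * p d = 0"
    using n(2) c0 pos'[of d] by (auto simp: nab)
  have "p 0 = 0" using hom[of 2 0] by simp
  then have "0 \<le> b" using pos[of 0 1] by simp
  moreover have "b \<noteq> 0"
  proof
    assume b: "b = 0"
    have "0 \<le> a \<bullet> (- a)" using pos'[of "- a"] b by simp
    then have "a = 0" by (simp flip: not_less)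
    then show False using n(1) nab b by (simp add: zero_prod_def)
  qed
  ultimately have b: "0 < b" by simp
  show thesis
  proof
    show "(- (1 / b) *\<^sub>R a) \<bullet> u \<le> p u" for u
      using pos'[of u] b by (simp add: field_simps)
    show "(- (1 / b) *\<^sub>R a) \<bullet> d = p d"
      using touch b by (simp add: field_simps)
  qed
qed

text \<open>
  The hypothesis holds in particular if the upper right Dini derivative is nonnegative at interior
  points. The last point \<open>m\<close> at which \<open>f\<close> is not below the line of slope \<open>- e\<close> through \<open>(t, f t)\<close> must be
  \<open>b\<close>, because otherwise the hypothesis at \<open>m\<close> yields a later one. Then \<open>e\<close> tends to \<open>0\<close> and
  \<open>t\<close> to \<open>a\<close>. The left end point is excluded from the hypothesis since paramonotonicity does not
  relate different subgradients at the same point.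
\<close>
lemma dini_increasing:
  fixes f :: "real \<Rightarrow> real"
  assumes "a < b" and cont: "continuous_on {a..b} f"
    and dini: "\<And>t e. \<lbrakk>a < t; t < b; 0 < e\<rbrakk> \<Longrightarrow> \<exists>s. t < s \<and> s \<le> b \<and> f t - e * (s - t) \<le> f s"
  shows "f a \<le> f b"
proof -
  have step: "f t - e * (b - t) \<le> f b" if t: "a < t" "t < b" and e: "0 < e" for t e
  proof -
    define A where "A = {s\<in>{t..b}. f t - e * (s - t) \<le> f s}"
    have ct: "continuous_on {t..b} f" using cont t by (auto elim: continuous_on_subset)
    have "closed A"
      unfolding A_def by (intro continuous_on_closed_Collect_le continuous_intros ct closed_atLeastAtMost)
    then have "compact A"
      using compact_Icc[of t b] by (metis (no_types, lifting) A_def mem_Collect_eq bounded_closed_interval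
        bounded_subset compact_eq_bounded_closed subsetI)
    moreover have "t \<in> A" using t by (simp add: A_def)
    ultimately obtain m where m: "m \<in> A" "\<And>s. s \<in> A \<Longrightarrow> s \<le> m"
      using compact_attains_sup[of A] by blast
    have "m = b"
    proof (rule ccontr)
      assume "m \<noteq> b"
      then have "m < b" "a < m" using m(1) t by (auto simp: A_def)
      then obtain s where s: "m < s" "s \<le> b" "f m - e * (s - m) \<le> f s"
        using dini e by blast
      then have "s \<in> A" using m(1) by (auto simp: A_def algebra_simps)
      then show False using m(2) s(1) by fastforce
    qed
    then show ?thesis using m(1) by (simp add: A_def)
  qed
  have "f t \<le> f b" if t: "a < t" "t < b" for t
  proof (rule tendsto_upperbound)
    show "((\<lambda>e. f t - e * (b - t)) \<longlongrightarrow> f t) (at_right 0)"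
      by (auto intro!: tendsto_eq_intros)
    show "\<forall>\<^sub>F e in at_right 0. f t - e * (b - t) \<le> f b"
      using step[OF t] by (auto simp: eventually_at_filter)
  qed simp
  then have "\<forall>\<^sub>F t in at_right a. f t \<le> f b"
    using eventually_at_right_less[of a] eventually_at_right_real[OF \<open>a < b\<close>]
    by (auto elim: eventually_mono)
  moreover have "(f \<longlongrightarrow> f a) (at_right a)"
    using cont \<open>a < b\<close> by (simp add: continuous_on_Icc_at_rightD)
  ultimately show ?thesis by (intro tendsto_upperbound) auto
qed

section \<open>The Clarke derivative of a locally Lipschitz function\<close>

text \<open>
  The upper limit that defines the Clarke derivative may be evaluated along moving base points;
  this is what makes the Clarke derivative subadditive in the direction.
\<close>
lemma clarke_filter_shift:
  fixes x d :: "'a::real_normed_vector"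
  shows "filterlim (\<lambda>(y, t). (y + t *\<^sub>R d, t))
    (nhds x \<times>\<^sub>F at_right (0::real)) (nhds x \<times>\<^sub>F at_right 0)"
proof -
  have fst: "(fst \<longlongrightarrow> x) (nhds x \<times>\<^sub>F at_right (0::real))"
    by (rule filterlim_fst)
  have snd: "filterlim snd (at_right (0::real)) (nhds x \<times>\<^sub>F at_right (0::real))"
    by (rule filterlim_snd)
  then have "(snd \<longlongrightarrow> (0::real)) (nhds x \<times>\<^sub>F at_right (0::real))"
    by (simp add: filterlim_at)
  then have "((\<lambda>z. fst z + snd z *\<^sub>R d) \<longlongrightarrow> x + 0 *\<^sub>R d) (nhds x \<times>\<^sub>F at_right (0::real))"
    using fst by (intro tendsto_intros)
  then show ?thesis
    using snd by (simp add: case_prod_unfold filterlim_Pair)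
qed

lemma clarke_filter_scale:
  fixes x :: "'a::real_normed_vector" and s :: real
  assumes "0 < s"
  shows "filterlim (\<lambda>(y, t). (y, s * t))
    (nhds x \<times>\<^sub>F at_right 0) (nhds x \<times>\<^sub>F at_right 0)"
proof -
  have "filterlim (\<lambda>t. s * t) (at_right 0) (at_right 0)"
    unfolding filterlim_at using assms
    by (auto intro!: tendsto_eq_intros simp: eventually_at_filter)
  then have "filterlim (\<lambda>z. s * snd z) (at_right 0) (nhds x \<times>\<^sub>F at_right 0)"
    using filterlim_compose[OF _ filterlim_snd] by blast
  then show ?thesis
    by (simp add: case_prod_unfold filterlim_Pair filterlim_fst)
qed

lemma eventually_clarke_filter_openI:
  fixes x d :: "'a::real_normed_vector"
  assumes "open U" "x \<in> U"
  shows "\<forall>\<^sub>F (y, t) in nhds x \<times>\<^sub>F at_right (0::real). 0 < t \<and> y \<in> U \<and> y + t *\<^sub>R d \<in> U"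
proof -
  have U: "\<forall>\<^sub>F z in nhds x \<times>\<^sub>F at_right (0::real). fst z \<in> U"
    using filterlim_fst[of "nhds x" "at_right (0::real)"] assms by (rule topological_tendstoD)
  moreover have "\<forall>\<^sub>F z in nhds x \<times>\<^sub>F at_right (0::real). 0 < snd z"
    by (rule eventually_compose_filterlim[OF eventually_at_right_less filterlim_snd])
  moreover have "\<forall>\<^sub>F z in nhds x \<times>\<^sub>F at_right (0::real). fst z + snd z *\<^sub>R d \<in> U"
    using eventually_compose_filterlim[OF U clarke_filter_shift[of d x]]
    by (simp add: case_prod_unfold)
  ultimately show ?thesis
    by eventually_elim auto
qed

text \<open>
  The quotients near \<open>x\<close> are finite, so the extended-real upper limit becomes a statement about real
  increments, with the denominator cleared.
\<close>
lemma clarke_dderiv_le_iff: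
  fixes h :: "'a::euclidean_space \<Rightarrow> ereal"
  assumes "proper_fun h" and "locally_lipschitz_at h x"
  shows "clarke_dderiv h x d \<le> ereal r \<longleftrightarrow>
    (\<forall>c>r. \<forall>\<^sub>F (y, t) in nhds x \<times>\<^sub>F at_right 0.
       real_of_ereal (h (y + t *\<^sub>R d)) - real_of_ereal (h y) < c * t)" (is "_ \<longleftrightarrow> (\<forall>c>r. ?P c)")
proof -
  let ?F = "nhds x \<times>\<^sub>F at_right (0::real)"
  let ?q = "\<lambda>(y, t). (h (y + t *\<^sub>R d) - h y) / ereal t"
  obtain U where U: "open U" "x \<in> U" "U \<subseteq> effective_domain h"
    using assms(2) unfolding locally_lipschitz_at_def by blast
  have fin: "h y = ereal (real_of_ereal (h y))" if "y \<in> U" for y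
    using that U(3) assms(1) by (cases "h y") (auto simp: effective_domain_def proper_fun_def)
  have eq: "?P c \<longleftrightarrow> (\<forall>\<^sub>F z in ?F. ?q z < ereal c)" for c
  proof (rule eventually_cong[OF eventually_clarke_filter_openI[OF U(1,2)]])
    fix z assume z: "case z of (y, t) \<Rightarrow> 0 < t \<and> y \<in> U \<and> y + t *\<^sub>R d \<in> U"
    obtain y t where [simp]: "z = (y, t)" by (cases z)
    obtain u v where "h y = ereal u" "h (y + t *\<^sub>R d) = ereal v" using fin z by auto
    then show "(case z of (y, t) \<Rightarrow> real_of_ereal (h (y + t *\<^sub>R d)) - real_of_ereal (h y) < c * t)
      \<longleftrightarrow> ?q z < ereal c"
      using z by (simp add: divide_simps)
  qed
  have "clarke_dderiv h x d \<le> ereal r \<longleftrightarrow> (\<forall>y>ereal r. \<forall>\<^sub>F z in ?F. ?q z < y)"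
    unfolding clarke_dderiv_def Limsup_le_iff ..
  also have "\<dots> \<longleftrightarrow> (\<forall>c>r. \<forall>\<^sub>F z in ?F. ?q z < ereal c)"
  proof safe
    fix y assume *: "\<forall>c>r. \<forall>\<^sub>F z in ?F. ?q z < ereal c" and "ereal r < y"
    then obtain c where c: "ereal r < ereal c" "ereal c < y" using ereal_dense2 by blast
    then have "\<forall>\<^sub>F z in ?F. ?q z < ereal c" using * by simp
    then show "\<forall>\<^sub>F z in ?F. ?q z < y" by eventually_elim (use c in auto)
  qed auto
  finally show ?thesis using eq by simp
qed

lemma clarke_dderiv_finite:
  fixes h :: "'a::euclidean_space \<Rightarrow> ereal"
  assumes "proper_fun h" and "locally_lipschitz_at h x"
  shows "\<bar>clarke_dderiv h x d\<bar> \<noteq> \<infinity>"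
proof -
  let ?F = "nhds x \<times>\<^sub>F at_right (0::real)" and ?g = "\<lambda>y. real_of_ereal (h y)"
  have ntriv: "?F \<noteq> bot" by (simp add: prod_filter_eq_bot)
  obtain U L where U: "open U" "x \<in> U" and L: "L-lipschitz_on U ?g"
    using assms(2) unfolding locally_lipschitz_at_def by blast
  have lip: "\<forall>\<^sub>F (y, t) in ?F. \<bar>?g (y + t *\<^sub>R d) - ?g y\<bar> \<le> L * norm d * t \<and> 0 < t"
    using eventually_clarke_filter_openI[OF U, where d=d]
  proof eventually_elim
    case (elim z)
    then show ?case
      using lipschitz_onD[OF L, of "fst z + snd z *\<^sub>R d" "fst z"]
      by (auto simp: dist_norm mult_ac)
  qed
  have "clarke_dderiv h x d \<le> ereal (L * norm d)"
    unfolding clarke_dderiv_le_iff[OF assms]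
  proof (intro allI impI)
    fix c assume c: "L * norm d < c"
    show "\<forall>\<^sub>F (y, t) in ?F. ?g (y + t *\<^sub>R d) - ?g y < c * t"
      using lip
    proof eventually_elim
      case (elim z)
      obtain y t where [simp]: "z = (y, t)" by (cases z)
      have "L * norm d * t < c * t" using elim by (intro mult_strict_right_mono c) auto
      moreover have "\<bar>?g (y + t *\<^sub>R d) - ?g y\<bar> \<le> L * norm d * t" using elim by simp
      ultimately have "?g (y + t *\<^sub>R d) - ?g y < c * t" by linarith
      then show ?case by simp
    qed
  qed
  moreover have "clarke_dderiv h x d \<noteq> -\<infinity>"
  proof
    assume "clarke_dderiv h x d = -\<infinity>"
    then have "clarke_dderiv h x d \<le> ereal (- L * norm d - 1)" by simp
    then have "\<forall>\<^sub>F (y, t) in ?F. ?g (y + t *\<^sub>R d) - ?g y < (- L * norm d) * t"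
      unfolding clarke_dderiv_le_iff[OF assms] by (rule allE[of _ "- L * norm d"]) simp
    with lip have "\<forall>\<^sub>F z in ?F. False" by eventually_elim auto
    then show False using ntriv by simp
  qed
  ultimately show ?thesis by auto
qed

text \<open>
  The increment in the direction \<open>u + v\<close> from \<open>y\<close> is the increment in the direction \<open>u\<close> from
  \<open>y\<close> plus the one in the direction \<open>v\<close> from \<open>y + t *\<^sub>R u\<close>.
\<close>
lemma clarke_dderiv_add_le:
  fixes h :: "'a::euclidean_space \<Rightarrow> ereal"
  assumes h: "proper_fun h" "locally_lipschitz_at h x"
    and u: "clarke_dderiv h x u \<le> ereal p" and v: "clarke_dderiv h x v \<le> ereal q"
  shows "clarke_dderiv h x (u + v) \<le> ereal (p + q)"
  unfolding clarke_dderiv_le_iff[OF h]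
proof (intro allI impI)
  let ?F = "nhds x \<times>\<^sub>F at_right (0::real)" and ?g = "\<lambda>y. real_of_ereal (h y)"
  fix c assume c: "p + q < c"
  define e where "e = (c - p - q) / 2"
  have e: "0 < e" "c = (p + e) + (q + e)" using c by (auto simp: e_def field_simps)
  have "\<forall>\<^sub>F (y, t) in ?F. ?g (y + t *\<^sub>R u) - ?g y < (p + e) * t"
    using u e(1) unfolding clarke_dderiv_le_iff[OF h] by simp
  moreover have "\<forall>\<^sub>F (y, t) in ?F. ?g (y + t *\<^sub>R v) - ?g y < (q + e) * t"
    using v e(1) unfolding clarke_dderiv_le_iff[OF h] by simp
  then have "\<forall>\<^sub>F z in ?F. case (case z of (y, t) \<Rightarrow> (y + t *\<^sub>R u, t)) of (y, t) \<Rightarrow>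
      ?g (y + t *\<^sub>R v) - ?g y < (q + e) * t"
    by (rule eventually_compose_filterlim) (rule clarke_filter_shift)
  ultimately show "\<forall>\<^sub>F (y, t) in ?F. ?g (y + t *\<^sub>R (u + v)) - ?g y < c * t"
  proof eventually_elim
    case (elim z)
    then show ?case by (cases z) (simp add: e(2) algebra_simps)
  qed
qed

lemma clarke_dderiv_scale_le:
  fixes h :: "'a::euclidean_space \<Rightarrow> ereal"
  assumes h: "proper_fun h" "locally_lipschitz_at h x"
    and s: "0 < s" and u: "clarke_dderiv h x u \<le> ereal p"
  shows "clarke_dderiv h x (s *\<^sub>R u) \<le> ereal (s * p)"
  unfolding clarke_dderiv_le_iff[OF h]
proof (intro allI impI)
  let ?F = "nhds x \<times>\<^sub>F at_right (0::real)" and ?g = "\<lambda>y. real_of_ereal (h y)"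
  fix c assume "s * p < c"
  then have "p < c / s" using s by (simp add: field_simps)
  then have "\<forall>\<^sub>F (y, t) in ?F. ?g (y + t *\<^sub>R u) - ?g y < c / s * t"
    using u unfolding clarke_dderiv_le_iff[OF h] by blast
  then have "\<forall>\<^sub>F z in ?F. case (case z of (y, t) \<Rightarrow> (y, s * t)) of (y, t) \<Rightarrow>
      ?g (y + t *\<^sub>R u) - ?g y < c / s * t"
    by (rule eventually_compose_filterlim) (rule clarke_filter_scale[OF s])
  then show "\<forall>\<^sub>F (y, t) in ?F. ?g (y + t *\<^sub>R (s *\<^sub>R u)) - ?g y < c * t"
  proof eventually_elim
    case (elim z)
    then show ?case using s by (cases z) (simp add: mult_ac)
  qed
qed

text \<open>
  The Clarke derivative is the support function of the Clarke subdifferential, and the supremum is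
  attained; in particular the subdifferential is nonempty.
\<close>
lemma clarke_subgradient_attaining:
  fixes h :: "'a::euclidean_space \<Rightarrow> ereal"
  assumes h: "proper_fun h" "locally_lipschitz_at h x"
  obtains \<zeta> where "\<zeta> \<in> clarke_subdiff h x" and "clarke_dderiv h x d = ereal (\<zeta> \<bullet> d)"
proof -
  define p where "p u = real_of_ereal (clarke_dderiv h x u)" for u
  have p: "clarke_dderiv h x u = ereal (p u)" for u
    using clarke_dderiv_finite[OF h, of u] by (simp add: p_def ereal_real)
  have sub: "p (u + v) \<le> p u + p v" for u v
    using clarke_dderiv_add_le[OF h, of u "p u" v "p v"] by (simp add: p)
  have scale: "p (s *\<^sub>R u) \<le> s * p u" if "0 < s" for s u
    using clarke_dderiv_scale_le[OF h that, of u "p u"] by (simp add: p)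
  have hom: "p (s *\<^sub>R u) = s * p u" if s: "0 < s" for s u
    using scale[OF s, of u] scale[of "1 / s" "s *\<^sub>R u"] s by (simp add: field_simps)
  obtain \<zeta> where "\<And>u. \<zeta> \<bullet> u \<le> p u" "\<zeta> \<bullet> d = p d"
    using sublinear_support[of p d] sub hom by blast
  then show thesis
    using that[of \<zeta>] by (simp add: clarke_subdiff_def p)
qed


text \<open>
  Take a subgradient \<open>\<eta>\<close> that attains the Clarke derivative in the direction \<open>- d\<close>. Going back
  from \<open>x + t *\<^sub>R d\<close> to \<open>x\<close> is a step in that direction from a base point that tends to \<open>x\<close>,
  so \<open>h\<close> rises on it by at most about \<open>- t * (\<eta> \<bullet> d)\<close>.
\<close>
lemma clarke_subgradient_lower_dini:
  fixes h :: "'a::euclidean_space \<Rightarrow> ereal"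
  assumes h: "proper_fun h" "locally_lipschitz_at h x"
  obtains \<eta> where "\<eta> \<in> clarke_subdiff h x"
    and "\<And>e. 0 < e \<Longrightarrow> \<forall>\<^sub>F t in at_right 0.
      real_of_ereal (h x) + t * (\<eta> \<bullet> d - e) \<le> real_of_ereal (h (x + t *\<^sub>R d))"
proof -
  let ?F = "nhds x \<times>\<^sub>F at_right (0::real)" and ?g = "\<lambda>y. real_of_ereal (h y)"
  obtain \<eta> where \<eta>: "\<eta> \<in> clarke_subdiff h x" "clarke_dderiv h x (- d) = ereal (\<eta> \<bullet> (- d))"
    using clarke_subgradient_attaining[OF h] by blast
  have "\<forall>\<^sub>F t in at_right 0. ?g x + t * (\<eta> \<bullet> d - e) \<le> ?g (x + t *\<^sub>R d)" if "0 < e" for e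
  proof -
    have "\<forall>\<^sub>F (y, t) in ?F. ?g (y + t *\<^sub>R (- d)) - ?g y < (\<eta> \<bullet> (- d) + e) * t"
      using \<eta>(2) that clarke_dderiv_le_iff[OF h, of "- d" "\<eta> \<bullet> (- d)"] by simp
    moreover have "filterlim (\<lambda>t. (x + t *\<^sub>R d, t)) ?F (at_right 0)"
      by (intro filterlim_Pair filterlim_ident) (auto intro!: tendsto_eq_intros)
    ultimately have "\<forall>\<^sub>F t in at_right 0. case (x + t *\<^sub>R d, t) of (y, t) \<Rightarrow>
        ?g (y + t *\<^sub>R (- d)) - ?g y < (\<eta> \<bullet> (- d) + e) * t"
      by (rule eventually_compose_filterlim)
    then show ?thesis by eventually_elim (simp add: algebra_simps)
  qed
  with \<eta>(1) show thesis by (rule that)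
qed

section \<open>Paraconvexity and the subgradient inequality\<close>

lemma locally_lipschitz_on_imp_continuous_on:
  assumes "locally_lipschitz_on h S"
  shows "continuous_on S (\<lambda>y. real_of_ereal (h y))"
proof (rule continuous_at_imp_continuous_on, rule ballI)
  fix x assume "x \<in> S"
  then obtain U L where "open U" "x \<in> U" "L-lipschitz_on U (\<lambda>y. real_of_ereal (h y))"
    using assms unfolding locally_lipschitz_on_def locally_lipschitz_at_def by blast
  then show "isCont (\<lambda>y. real_of_ereal (h y)) x"
    using lipschitz_on_continuous_on continuous_on_eq_continuous_at by blast
qed

lemma proper_finite_on:
  assumes "proper_fun h" "S \<subseteq> effective_domain h" "x \<in> S"
  shows "h x = ereal (real_of_ereal (h x))"
  using assms by (cases "h x") (auto simp: effective_domain_def proper_fun_def)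

lemma paraconvex_on_iff_real:
  fixes h :: "'a::euclidean_space \<Rightarrow> ereal"
  assumes "proper_fun h" "S \<subseteq> effective_domain h" "convex S"
  shows "paraconvex_on \<nu> \<rho> S h \<longleftrightarrow>
    (\<forall>x\<in>S. \<forall>y\<in>S. \<forall>l\<in>{0..1}.
      real_of_ereal (h (l *\<^sub>R x + (1 - l) *\<^sub>R y))
        \<le> l * real_of_ereal (h x) + (1 - l) * real_of_ereal (h y)
          + \<rho> * min l (1 - l) * norm (x - y) powr (1 + \<nu>))"
proof -
  have "h (l *\<^sub>R x + (1 - l) *\<^sub>R y)
          \<le> ereal l * h x + ereal (1 - l) * h y
            + ereal (\<rho> * min l (1 - l) * norm (x - y) powr (1 + \<nu>)) \<longleftrightarrow>
    real_of_ereal (h (l *\<^sub>R x + (1 - l) *\<^sub>R y))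
        \<le> l * real_of_ereal (h x) + (1 - l) * real_of_ereal (h y)
          + \<rho> * min l (1 - l) * norm (x - y) powr (1 + \<nu>)"
    if xy: "x \<in> S" "y \<in> S" and l: "l \<in> {0..1}" for x y l
  proof -
    have "l *\<^sub>R x + (1 - l) *\<^sub>R y \<in> S" using convexD[OF assms(3) xy, of l "1 - l"] l by simp
    then obtain u v w where "h x = ereal u" "h y = ereal v" "h (l *\<^sub>R x + (1 - l) *\<^sub>R y) = ereal w"
      using proper_finite_on[OF assms(1,2)] xy by metis
    then show ?thesis by simp
  qed
  then show ?thesis using assms(2,3) unfolding paraconvex_on_def by auto
qed

text \<open>
  For a base point \<open>w\<close> near \<open>x\<close> and a small step \<open>t\<close>, paraconvexity between \<open>w + d\<close> and \<open>w\<close>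
  bounds the difference quotient at \<open>w\<close> by \<open>h (w + d) - h w + \<rho> * norm d powr (1 + \<nu>)\<close>. The bound
  is free of \<open>t\<close>, and continuous in \<open>w\<close>.
\<close>
lemma paraconvex_on_imp_subgradient_ineq:
  fixes h :: "'a::euclidean_space \<Rightarrow> ereal"
  assumes h: "proper_fun h" and lip: "locally_lipschitz_on h S" and dom: "S \<subseteq> effective_domain h"
    and "open S" and "convex S" and pc: "paraconvex_on \<nu> \<rho> S h"
    and x: "x \<in> S" and y: "y \<in> S" and \<zeta>: "\<zeta> \<in> clarke_subdiff h x"
  shows "real_of_ereal (h x) + \<zeta> \<bullet> (y - x) - \<rho> * norm (y - x) powr (1 + \<nu>) \<le> real_of_ereal (h y)"
proof -
  let ?F = "nhds x \<times>\<^sub>F at_right (0::real)" and ?g = "\<lambda>y. real_of_ereal (h y)"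
  define d where "d = y - x"
  define K where "K = \<rho> * norm d powr (1 + \<nu>)"
  have lipx: "locally_lipschitz_at h x" using lip x by (simp add: locally_lipschitz_on_def)
  have cont: "(?g \<longlongrightarrow> ?g z) (nhds z)" if "z \<in> S" for z
    using locally_lipschitz_on_imp_continuous_on[OF lip] \<open>open S\<close> that
    by (simp add: continuous_on_eq_continuous_at isCont_def tendsto_nhds_iff)
  have fst: "(fst \<longlongrightarrow> x) ?F" by (rule filterlim_fst)
  have fstd: "((\<lambda>z. fst z + d) \<longlongrightarrow> y) ?F"
    using tendsto_add[OF fst tendsto_const, of d] by (simp add: d_def)
  have "clarke_dderiv h x d \<le> ereal (?g y - ?g x + K)"
    unfolding clarke_dderiv_le_iff[OF h lipx]
  proof (intro allI impI)
    fix c assume c: "?g y - ?g x + K < c"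
    have "((\<lambda>z. ?g (fst z + d) - ?g (fst z) + K) \<longlongrightarrow> ?g y - ?g x + K) ?F"
      by (intro tendsto_intros filterlim_compose[OF cont fstd] filterlim_compose[OF cont fst] x y)
    then have "\<forall>\<^sub>F z in ?F. ?g (fst z + d) - ?g (fst z) + K < c"
      using c by (rule order_tendstoD)
    moreover have "\<forall>\<^sub>F z in ?F. fst z + d \<in> S"
      using topological_tendstoD[OF fstd \<open>open S\<close> y] .
    moreover have "\<forall>\<^sub>F z in ?F. fst z \<in> S"
      using topological_tendstoD[OF fst \<open>open S\<close> x] .
    \<comment> \<open>Below one half, the minimum of \<open>t\<close> and \<open>1 - t\<close> is \<open>t\<close> and cancels against the step.\<close>
    moreover have "\<forall>\<^sub>F z in ?F. snd z \<in> {0<..<1/2}"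
      by (rule eventually_compose_filterlim[OF eventually_at_right_real filterlim_snd]) simp
    ultimately show "\<forall>\<^sub>F (y, t) in ?F. ?g (y + t *\<^sub>R d) - ?g y < c * t"
    proof eventually_elim
      case (elim z)
      obtain w t where [simp]: "z = (w, t)" by (cases z)
      have t: "0 < t" "t \<le> 1" "min t (1 - t) = t" using elim by auto
      have "?g (t *\<^sub>R (w + d) + (1 - t) *\<^sub>R w)
          \<le> t * ?g (w + d) + (1 - t) * ?g w + \<rho> * t * norm (w + d - w) powr (1 + \<nu>)"
        using pc[unfolded paraconvex_on_iff_real[OF h dom \<open>convex S\<close>], rule_format, of "w + d" w t]
          elim t by simp
      then have "?g (w + t *\<^sub>R d) \<le> t * ?g (w + d) + (1 - t) * ?g w + t * K"
        by (simp add: algebra_simps K_def)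
      then have "?g (w + t *\<^sub>R d) - ?g w \<le> (?g (w + d) - ?g w + K) * t"
        by (simp add: algebra_simps)
      also have "\<dots> < c * t" using elim t(1) by (intro mult_strict_right_mono) auto
      finally show ?case by simp
    qed
  qed
  moreover have "ereal (\<zeta> \<bullet> d) \<le> clarke_dderiv h x d"
    using \<zeta> by (simp add: clarke_subdiff_def)
  ultimately have "ereal (\<zeta> \<bullet> d) \<le> ereal (?g y - ?g x + K)" by (rule order_trans[rotated])
  then show ?thesis by (simp add: d_def K_def)
qed

lemma powr_le_tangent_at_1:
  fixes u \<nu> :: real
  assumes "0 \<le> u" "0 < \<nu>" "\<nu> \<le> 1"
  shows "u powr \<nu> \<le> 1 + \<nu> * (u - 1)"
proof (cases "u = 0")
  case False
  then show ?thesis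
    using Youngs_inequality_0[of \<nu> "1 - \<nu>" u 1] assms by (simp add: algebra_simps)
qed (use assms in simp)

text \<open>
  By concavity the sum is largest at \<open>l = 1 / 2\<close>. Doubling the arguments moves that point to \<open>1\<close>,
  where the tangent bounds of the two summands add up to a constant.
\<close>
lemma powr_add_complement_le:
  fixes l \<nu> :: real
  assumes "0 \<le> l" "l \<le> 1" "0 < \<nu>" "\<nu> \<le> 1"
  shows "l powr \<nu> + (1 - l) powr \<nu> \<le> 2 powr (1 - \<nu>)"
proof -
  have "2 powr \<nu> * (l powr \<nu> + (1 - l) powr \<nu>) = (2 * l) powr \<nu> + (2 * (1 - l)) powr \<nu>"
    using assms powr_mult[of 2 l \<nu>] powr_mult[of 2 "1 - l" \<nu>] by (simp add: distrib_left)
  also have "\<dots> \<le> (1 + \<nu> * (2 * l - 1)) + (1 + \<nu> * (2 * (1 - l) - 1))"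
    using assms by (intro add_mono powr_le_tangent_at_1) auto
  also have "\<dots> = 2" by (simp add: algebra_simps)
  finally show ?thesis by (simp add: powr_diff field_simps)
qed

text \<open>
  The weighted average of the inequalities at \<open>z = l *\<^sub>R x + (1 - l) *\<^sub>R y\<close> towards \<open>x\<close> and
  \<open>y\<close> has no linear term, and its error is \<open>\<rho> * norm (x - y) powr (1 + \<nu>)\<close> times
  \<open>l * (1 - l) * (l powr \<nu> + (1 - l) powr \<nu>)\<close>.
\<close>
lemma subgradient_ineq_imp_paraconvex_on:
  fixes h :: "'a::euclidean_space \<Rightarrow> ereal"
  assumes h: "proper_fun h" and lip: "locally_lipschitz_on h S" and dom: "S \<subseteq> effective_domain h"
    and "convex S" and \<nu>: "0 < \<nu>" "\<nu> \<le> 1" and "0 \<le> \<rho>"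
    and sub: "\<And>x y \<zeta>. \<lbrakk>x \<in> S; y \<in> S; \<zeta> \<in> clarke_subdiff h x\<rbrakk> \<Longrightarrow>
      real_of_ereal (h x) + \<zeta> \<bullet> (y - x) - \<rho> * norm (y - x) powr (1 + \<nu>) \<le> real_of_ereal (h y)"
  shows "paraconvex_on \<nu> (2 powr (1 - \<nu>) * \<rho>) S h"
  unfolding paraconvex_on_iff_real[OF h dom \<open>convex S\<close>]
proof (intro ballI)
  let ?g = "\<lambda>y. real_of_ereal (h y)"
  fix x y and l :: real assume x: "x \<in> S" and y: "y \<in> S" and l01: "l \<in> {0..1}"
  then have l: "0 \<le> l" "l \<le> 1" by auto
  define N where "N = norm (x - y) powr (1 + \<nu>)"
  define z where "z = l *\<^sub>R x + (1 - l) *\<^sub>R y"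
  have z: "z \<in> S" using convexD[OF \<open>convex S\<close> x y, of l "1 - l"] l by (simp add: z_def)
  then have "locally_lipschitz_at h z" using lip by (simp add: locally_lipschitz_on_def)
  then obtain \<zeta> where \<zeta>: "\<zeta> \<in> clarke_subdiff h z"
    using clarke_subgradient_attaining[OF h] by blast
  have xz: "x - z = (1 - l) *\<^sub>R (x - y)" and yz: "y - z = (- l) *\<^sub>R (x - y)"
    by (simp_all add: z_def algebra_simps)
  have nx: "norm (x - z) powr (1 + \<nu>) = (1 - l) powr (1 + \<nu>) * N"
    and ny: "norm (y - z) powr (1 + \<nu>) = l powr (1 + \<nu>) * N"
    using l by (simp_all add: xz yz N_def powr_mult)
  have "?g z + (1 - l) * (\<zeta> \<bullet> (x - y)) - \<rho> * ((1 - l) powr (1 + \<nu>) * N) \<le> ?g x"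
    using sub[OF z x \<zeta>] by (simp add: nx) (simp add: xz)
  then have 1: "l * (?g z + (1 - l) * (\<zeta> \<bullet> (x - y)) - \<rho> * ((1 - l) powr (1 + \<nu>) * N)) \<le> l * ?g x"
    using l by (intro mult_left_mono)
  have "?g z - l * (\<zeta> \<bullet> (x - y)) - \<rho> * (l powr (1 + \<nu>) * N) \<le> ?g y"
    using sub[OF z y \<zeta>] by (simp add: ny) (simp add: yz)
  then have 2: "(1 - l) * (?g z - l * (\<zeta> \<bullet> (x - y)) - \<rho> * (l powr (1 + \<nu>) * N)) \<le> (1 - l) * ?g y"
    using l by (intro mult_left_mono) auto
  have "l * (1 - l) powr (1 + \<nu>) + (1 - l) * l powr (1 + \<nu>)
      = l * (1 - l) * (l powr \<nu> + (1 - l) powr \<nu>)"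
    using l by (simp add: powr_add algebra_simps)
  also have "\<dots> \<le> min l (1 - l) * 2 powr (1 - \<nu>)"
    using l \<nu> powr_add_complement_le[of l \<nu>]
    by (intro mult_mono) (auto simp: min_def mult_left_le mult_right_le_one_le intro: mult_left_le_one_le)
  finally have "(\<rho> * N) * (l * (1 - l) powr (1 + \<nu>) + (1 - l) * l powr (1 + \<nu>))
      \<le> (\<rho> * N) * (min l (1 - l) * 2 powr (1 - \<nu>))"
    using \<open>0 \<le> \<rho>\<close> by (intro mult_left_mono) (simp_all add: N_def)
  with 1 2 have "?g z \<le> l * ?g x + (1 - l) * ?g y + 2 powr (1 - \<nu>) * \<rho> * min l (1 - l) * N"
    by (simp add: algebra_simps)
  then show "?g (l *\<^sub>R x + (1 - l) *\<^sub>R y) \<le> l * ?g x + (1 - l) * ?g y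
      + 2 powr (1 - \<nu>) * \<rho> * min l (1 - l) * norm (x - y) powr (1 + \<nu>)"
    by (simp add: z_def N_def)
qed

section \<open>From paramonotonicity to the subgradient inequality\<close>

lemma powr_increment_ge_tangent:
  fixes s t \<nu> :: real
  assumes "0 < t" "t < s" "0 < \<nu>"
  shows "(1 + \<nu>) * t powr \<nu> * (s - t) \<le> s powr (1 + \<nu>) - t powr (1 + \<nu>)"
proof -
  have "\<exists>z. t < z \<and> z < s \<and>
      s powr (1 + \<nu>) - t powr (1 + \<nu>) = (s - t) * ((1 + \<nu>) * z powr \<nu>)"
    using assms by (intro MVT2) (auto intro!: derivative_eq_intros simp: powr_diff)
  then obtain z where z: "t < z" "z < s"
      "s powr (1 + \<nu>) - t powr (1 + \<nu>) = (s - t) * ((1 + \<nu>) * z powr \<nu>)" by blast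
  have "t powr \<nu> \<le> z powr \<nu>" using z assms by (intro powr_mono2) auto
  then have "(s - t) * ((1 + \<nu>) * t powr \<nu>) \<le> (s - t) * ((1 + \<nu>) * z powr \<nu>)"
    using assms by (intro mult_left_mono) auto
  then show ?thesis using z(3) by (simp add: mult_ac)
qed

text \<open>
  Paramonotonicity between \<open>x\<close> and \<open>\<gamma> t = x + t *\<^sub>R d\<close>, divided by \<open>t\<close>, bounds the slope of
  \<open>h \<circ> \<gamma>\<close> at \<open>t\<close> from below by \<open>\<zeta> \<bullet> d - \<rho> * norm d powr (1 + \<nu>) * t powr \<nu>\<close>. Subtracting the
  antiderivative of this bound from \<open>h \<circ> \<gamma>\<close> leaves a nondecreasing function \<open>f\<close>; the claim is
  \<open>f 0 \<le> f 1\<close>.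
\<close>
lemma paramonotone_on_imp_subgradient_ineq:
  fixes h :: "'a::euclidean_space \<Rightarrow> ereal"
  assumes h: "proper_fun h" and lip: "locally_lipschitz_on h S"
    and "convex S" and "0 < \<nu>" and "0 \<le> \<rho>" and pm: "paramonotone_on \<nu> \<rho> S (clarke_subdiff h)"
    and x: "x \<in> S" and y: "y \<in> S" and \<zeta>: "\<zeta> \<in> clarke_subdiff h x"
  shows "real_of_ereal (h x) + \<zeta> \<bullet> (y - x) - \<rho> / (1 + \<nu>) * norm (y - x) powr (1 + \<nu>)
    \<le> real_of_ereal (h y)"
proof -
  let ?g = "\<lambda>y. real_of_ereal (h y)"
  define d where "d = y - x"
  define N where "N = norm d powr (1 + \<nu>)"
  define \<gamma> where "\<gamma> t = x + t *\<^sub>R d" for t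
  define K where "K = \<rho> / (1 + \<nu>) * N"
  define f where "f t = ?g (\<gamma> t) - t * (\<zeta> \<bullet> d) + K * t powr (1 + \<nu>)" for t
  have \<gamma>S: "\<gamma> t \<in> S" if "0 \<le> t" "t \<le> 1" for t
    using convexD_alt[OF \<open>convex S\<close> x y, of t] that by (simp add: \<gamma>_def d_def algebra_simps)
  have "f 0 \<le> f 1"
  proof (rule dini_increasing[where f = f])
    have "continuous_on {0..1} \<gamma>"
      unfolding \<gamma>_def by (intro continuous_intros)
    then have "continuous_on {0..1} (\<lambda>t. ?g (\<gamma> t))"
      by (rule continuous_on_compose2[OF locally_lipschitz_on_imp_continuous_on[OF lip]])
        (use \<gamma>S in auto)
    then show "continuous_on {0..1} f"
      unfolding f_def using \<open>0 < \<nu>\<close> by (intro continuous_intros continuous_on_powr') auto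
  next
    fix t e :: real assume t: "0 < t" "t < 1" and e: "0 < e"
    have "locally_lipschitz_at h (\<gamma> t)"
      using lip \<gamma>S[of t] t by (simp add: locally_lipschitz_on_def)
    then obtain \<eta> where \<eta>: "\<eta> \<in> clarke_subdiff h (\<gamma> t)"
      and ev: "\<forall>\<^sub>F r in at_right 0. ?g (\<gamma> t) + r * (\<eta> \<bullet> d - e) \<le> ?g (\<gamma> t + r *\<^sub>R d)"
      using clarke_subgradient_lower_dini[OF h] e by metis
    have "- \<rho> * (t * norm d) powr (1 + \<nu>) \<le> t * ((\<eta> - \<zeta>) \<bullet> d)"
      using pm x \<gamma>S[of t] \<zeta> \<eta> t unfolding paramonotone_on_def by (fastforce simp: \<gamma>_def)
    also have "- \<rho> * (t * norm d) powr (1 + \<nu>) = t * (- \<rho> * N * t powr \<nu>)"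
      using t by (simp add: N_def powr_mult powr_add)
    finally have "- \<rho> * N * t powr \<nu> \<le> (\<eta> - \<zeta>) \<bullet> d"
      using t(1) by (simp only: mult_le_cancel_left_pos)
    then have slope: "\<zeta> \<bullet> d - \<rho> * N * t powr \<nu> \<le> \<eta> \<bullet> d"
      by (simp add: inner_diff_left)
    have "\<forall>\<^sub>F r in at_right 0. r \<in> {0<..<1 - t}"
      using eventually_at_right_real[of 0 "1 - t"] t by simp
    with ev have "\<forall>\<^sub>F r in at_right 0. r \<in> {0<..<1 - t} \<and>
        ?g (\<gamma> t) + r * (\<eta> \<bullet> d - e) \<le> ?g (\<gamma> t + r *\<^sub>R d)"
      by eventually_elim simp
    from eventually_happens'[OF trivial_limit_at_right_real this]
    obtain r where r: "0 < r" "r < 1 - t"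
      "?g (\<gamma> t) + r * (\<eta> \<bullet> d - e) \<le> ?g (\<gamma> t + r *\<^sub>R d)"
      by auto
    show "\<exists>s>t. s \<le> 1 \<and> f t - e * (s - t) \<le> f s"
    proof (intro exI conjI)
      have "r * (\<zeta> \<bullet> d - \<rho> * N * t powr \<nu>) \<le> r * (\<eta> \<bullet> d)"
        using slope r by (intro mult_left_mono) auto
      moreover have "\<gamma> t + r *\<^sub>R d = \<gamma> (t + r)" by (simp add: \<gamma>_def algebra_simps)
      ultimately have g: "?g (\<gamma> t) + r * (\<zeta> \<bullet> d) - r * (\<rho> * N * t powr \<nu>) - r * e \<le> ?g (\<gamma> (t + r))"
        using r(3) by (simp add: algebra_simps)
      have "K * ((1 + \<nu>) * t powr \<nu> * r) \<le> K * ((t + r) powr (1 + \<nu>) - t powr (1 + \<nu>))"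
        using powr_increment_ge_tangent[of t "t + r" \<nu>] t r \<open>0 < \<nu>\<close> \<open>0 \<le> \<rho>\<close>
        by (intro mult_left_mono) (simp_all add: K_def N_def)
      moreover have "K * ((1 + \<nu>) * t powr \<nu> * r) = r * (\<rho> * N * t powr \<nu>)"
        using \<open>0 < \<nu>\<close> by (simp add: K_def)
      ultimately have "r * (\<rho> * N * t powr \<nu>) \<le> K * (t + r) powr (1 + \<nu>) - K * t powr (1 + \<nu>)"
        by (simp add: right_diff_distrib)
      with g show "f t - e * (t + r - t) \<le> f (t + r)" by (simp add: f_def algebra_simps)
    qed (use r in auto)
  qed simp
  then show ?thesis using \<open>0 < \<nu>\<close> by (simp add: f_def \<gamma>_def K_def N_def d_def)
qed

section \<open>The two equivalences\<close>

theorem theorem3p10: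
  fixes h :: "real ^ 'n \<Rightarrow> ereal" and S :: "(real ^ 'n) set" and \<nu> \<rho> :: real
  assumes "proper_fun h"
    and "S \<noteq> {}" and "convex S" and "S \<subseteq> interior (effective_domain h)"
    and "locally_lipschitz_on h S"
    and "0 < \<nu>" and "\<nu> \<le> 1" and "0 \<le> \<rho>"
  shows
    "((open S \<and> paraconvex_on \<nu> \<rho> S h \<longrightarrow>
        (\<forall>x\<in>S. \<forall>y\<in>S. \<forall>\<zeta>\<in>clarke_subdiff h x.
           h y \<ge> h x + ereal (\<zeta> \<bullet> (y - x)) - ereal (\<rho> * norm (y - x) powr (1 + \<nu>)))) \<and>
      ((\<forall>x\<in>S. \<forall>y\<in>S. \<forall>\<zeta>\<in>clarke_subdiff h x.
           h y \<ge> h x + ereal (\<zeta> \<bullet> (y - x)) - ereal (\<rho> * norm (y - x) powr (1 + \<nu>))) \<longrightarrow>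
        paraconvex_on \<nu> (2 powr (1 - \<nu>) * \<rho>) S h)) \<and>
     ((open S \<and> paraconvex_on \<nu> \<rho> S h \<longrightarrow>
        paramonotone_on \<nu> (2 * \<rho>) S (clarke_subdiff h)) \<and>
      (paramonotone_on \<nu> \<rho> S (clarke_subdiff h) \<longrightarrow>
        paraconvex_on \<nu> (2 powr (1 - \<nu>) * \<rho> / (1 + \<nu>)) S h))"
proof -
  let ?g = "\<lambda>y. real_of_ereal (h y)"
  have dom: "S \<subseteq> effective_domain h" using assms(4) interior_subset by blast
  note ctxt = assms(1,5) dom
  have toreal: "h x + ereal (\<zeta> \<bullet> (y - x)) - ereal (\<rho> * norm (y - x) powr (1 + \<nu>)) \<le> h y \<longleftrightarrow>
      ?g x + \<zeta> \<bullet> (y - x) - \<rho> * norm (y - x) powr (1 + \<nu>) \<le> ?g y"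
    if xy: "x \<in> S" "y \<in> S" for x y \<zeta>
  proof -
    obtain u v where "h x = ereal u" "h y = ereal v"
      using proper_finite_on[OF assms(1) dom] xy by metis
    then show ?thesis by simp
  qed
  note fwd = paraconvex_on_imp_subgradient_ineq[OF ctxt _ assms(3)]
  show ?thesis
  proof (intro conjI impI)
    assume "open S \<and> paraconvex_on \<nu> \<rho> S h"
    then show "\<forall>x\<in>S. \<forall>y\<in>S. \<forall>\<zeta>\<in>clarke_subdiff h x.
        h y \<ge> h x + ereal (\<zeta> \<bullet> (y - x)) - ereal (\<rho> * norm (y - x) powr (1 + \<nu>))"
      using fwd by (simp add: toreal)
  next
    assume "\<forall>x\<in>S. \<forall>y\<in>S. \<forall>\<zeta>\<in>clarke_subdiff h x.
        h y \<ge> h x + ereal (\<zeta> \<bullet> (y - x)) - ereal (\<rho> * norm (y - x) powr (1 + \<nu>))"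
    then show "paraconvex_on \<nu> (2 powr (1 - \<nu>) * \<rho>) S h"
      by (intro subgradient_ineq_imp_paraconvex_on ctxt assms(3,6,7,8)) (simp add: toreal)
  next
    assume "open S \<and> paraconvex_on \<nu> \<rho> S h"
    then have o: "open S" "paraconvex_on \<nu> \<rho> S h" by auto
    show "paramonotone_on \<nu> (2 * \<rho>) S (clarke_subdiff h)"
      unfolding paramonotone_on_def
    proof (intro ballI)
      fix x y \<zeta> \<eta> assume "x \<in> S" "y \<in> S" "\<zeta> \<in> clarke_subdiff h x" "\<eta> \<in> clarke_subdiff h y"
      then have "?g x + \<zeta> \<bullet> (y - x) - \<rho> * norm (y - x) powr (1 + \<nu>) \<le> ?g y"
        "?g y + \<eta> \<bullet> (x - y) - \<rho> * norm (x - y) powr (1 + \<nu>) \<le> ?g x"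
        using fwd[OF o] by auto
      then show "(\<eta> - \<zeta>) \<bullet> (y - x) \<ge> - (2 * \<rho>) * norm (x - y) powr (1 + \<nu>)"
        by (simp add: norm_minus_commute algebra_simps)
    qed
  next
    assume pm: "paramonotone_on \<nu> \<rho> S (clarke_subdiff h)"
    have "paraconvex_on \<nu> (2 powr (1 - \<nu>) * (\<rho> / (1 + \<nu>))) S h"
      using assms(6,7,8) paramonotone_on_imp_subgradient_ineq[OF assms(1,5,3,6,8) pm]
      by (intro subgradient_ineq_imp_paraconvex_on ctxt assms(3)) auto
    then show "paraconvex_on \<nu> (2 powr (1 - \<nu>) * \<rho> / (1 + \<nu>)) S h" by simp
  qed
qed

end
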